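(* Let $\mathcal{T}$ be a rooted prefix tree with finite set $V$ of cacheable chunks and let $\mathcal{M}=\{1,\ldots,M\}$ be workers with budgets $k_m$. Let $G$ be either of the two objectives $F$ or $F_{\rm pair}$ defined in the context. Fix any order of the workers before the run, and process the workers in this order, starting from the empty placement at every worker: when worker $m$ is processed, assign to it a parent-closed set $T_m\subseteq V$ with $|T_m|\le k_m$ that maximizes the exact marginal increase of $G$ over the placement formed by the previously processed workers (with all not-yet-processed workers empty). Then the resulting placement $\boldsymbol{T}^{G}$ is feasible and satisfies $$G(\boldsymbol{T}^{G})\ \ge\ \tfrac12\,G(\boldsymbol{T}^* ),$$ where $\boldsymbol{T}^*$ is a feasible placement maximizing $G$.
   Context: Notation: $[x]_+=\max\{x,0\}$. The tree may have an additional no-cost dummy root (not in $V$, always present, not consuming budget). A set $T\subseteq V$ is parent-closed if whenever a node is in $T$, every ancestor of it in $V$ is in $T$. A placement is a tuple $\boldsymbol{T}=(T_1,\ldots,T_M)$ of subsets of $V$; it is feasible if every $T_m$ is parent-closed and $|T_m|\le k_m$. Demands $\Lambda_m(b)\ge0$ and recomputation costs $w_m(b)\ge0$ are given for $m\in\mathcal{M}$, $b\in V$. Requester-side objective $F$: given fetch costs $f_m(b)\ge0$, $$F(\boldsymbol{T})=\sum_{m=1}^{M}\sum_{b\in T_m}a_m(b)+\sum_{b\in\bigcup_m T_m}\Delta(b),$$ with $a_m(b)=\Lambda_m(b)\min\{w_m(b),f_m(b)\}$ and $\Delta(b)=\sum_{m=1}^{M}\Lambda_m(b)[w_m(b)-f_m(b)]_+$.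 Source-dependent objective $F_{\rm pair}$: given arbitrary real fetch costs $f_{m\leftarrow h}(b)$ for $m\ne h$ (cost for requester $m$ to fetch $b$ from holder $h$), set $q_{m\leftarrow m}(b)=w_m(b)$ and $q_{m\leftarrow h}(b)=[w_m(b)-f_{m\leftarrow h}(b)]_+$ for $h\neq m$, and $$F_{\rm pair}(\boldsymbol{T})=\sum_{b\in V}\sum_{m=1}^{M}\Lambda_m(b)\max_{h:\,b\in T_h}q_{m\leftarrow h}(b),$$ where the maximum over the empty set is $0$. *)

theory Defs
  imports Complex_Main
begin

text \<open>A tree with node set \<open>N\<close> and root \<open>r\<close> is given by a parent map whose iterates lead from
  every node to the root. The value of the map at \<open>r\<close> is irrelevant. Acyclicity follows from the
  last condition.\<close>

definition rooted_tree :: "'b set \<Rightarrow> 'b \<Rightarrow> ('b \<Rightarrow> 'b) \<Rightarrow> bool" where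
  "rooted_tree N r par \<longleftrightarrow>
     r \<in> N \<and> (\<forall>b\<in>N - {r}. par b \<in> N) \<and> (\<forall>b\<in>N. \<exists>i. (par ^^ i) b = r)"

definition ancestor :: "'b set \<Rightarrow> 'b \<Rightarrow> ('b \<Rightarrow> 'b) \<Rightarrow> 'b \<Rightarrow> 'b \<Rightarrow> bool" where
  "ancestor N r par a b \<longleftrightarrow> (a, b) \<in> {(par c, c) | c. c \<in> N - {r}}\<^sup>+"

text \<open>The cacheable chunks \<open>V\<close> are either all nodes or all nodes but the root. In the latter case
  \<open>r\<close> is a dummy root, which is always present and uses no budget.\<close>

definition cache_tree :: "'b set \<Rightarrow> 'b \<Rightarrow> ('b \<Rightarrow> 'b) \<Rightarrow> 'b set \<Rightarrow> bool" where
  "cache_tree N r par V \<longleftrightarrow> rooted_tree N r par \<and> finite V \<and> (V = N \<or> V = N - {r})"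

definition parent_closed :: "'b set \<Rightarrow> 'b \<Rightarrow> ('b \<Rightarrow> 'b) \<Rightarrow> 'b set \<Rightarrow> 'b set \<Rightarrow> bool" where
  "parent_closed N r par V S \<longleftrightarrow> (\<forall>b\<in>S. \<forall>a\<in>V. ancestor N r par a b \<longrightarrow> a \<in> S)"

definition admissible ::
  "'b set \<Rightarrow> 'b \<Rightarrow> ('b \<Rightarrow> 'b) \<Rightarrow> 'b set \<Rightarrow> nat \<Rightarrow> 'b set \<Rightarrow> bool" where
  "admissible N r par V K S \<longleftrightarrow> S \<subseteq> V \<and> parent_closed N r par V S \<and> card S \<le> K"

text \<open>The placement \<open>(T\<^sub>1, \<dots>, T\<^sub>M)\<close> is a function on \<open>nat\<close> of which only the values on
  \<open>{1..M}\<close> are ever used.\<close>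

type_synonym 'b placement = "nat \<Rightarrow> 'b set"

definition feasible ::
  "'b set \<Rightarrow> 'b \<Rightarrow> ('b \<Rightarrow> 'b) \<Rightarrow> 'b set \<Rightarrow> nat \<Rightarrow> (nat \<Rightarrow> nat) \<Rightarrow> 'b placement \<Rightarrow> bool" where
  "feasible N r par V M k T \<longleftrightarrow> (\<forall>m\<in>{1..M}. admissible N r par V (k m) (T m))"

definition pos_part :: "real \<Rightarrow> real" where
  "pos_part x = max x 0"

definition local_gain ::
  "(nat \<Rightarrow> 'b \<Rightarrow> real) \<Rightarrow> (nat \<Rightarrow> 'b \<Rightarrow> real) \<Rightarrow> (nat \<Rightarrow> 'b \<Rightarrow> real) \<Rightarrow> nat \<Rightarrow> 'b \<Rightarrow> real" where
  "local_gain \<Lambda> w f m b = \<Lambda> m b * min (w m b) (f m b)"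

definition shared_gain ::
  "nat \<Rightarrow> (nat \<Rightarrow> 'b \<Rightarrow> real) \<Rightarrow> (nat \<Rightarrow> 'b \<Rightarrow> real) \<Rightarrow> (nat \<Rightarrow> 'b \<Rightarrow> real) \<Rightarrow> 'b \<Rightarrow> real" where
  "shared_gain M \<Lambda> w f b = (\<Sum>m\<in>{1..M}. \<Lambda> m b * pos_part (w m b - f m b))"

definition F ::
  "nat \<Rightarrow> (nat \<Rightarrow> 'b \<Rightarrow> real) \<Rightarrow> (nat \<Rightarrow> 'b \<Rightarrow> real) \<Rightarrow> (nat \<Rightarrow> 'b \<Rightarrow> real) \<Rightarrow> 'b placement \<Rightarrow> real"
  where
  "F M \<Lambda> w f T =
     (\<Sum>m\<in>{1..M}. \<Sum>b\<in>T m. local_gain \<Lambda> w f m b)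
     + (\<Sum>b\<in>(\<Union>m\<in>{1..M}. T m). shared_gain M \<Lambda> w f b)"

text \<open>In \<open>g m h b\<close> the requester is \<open>m\<close> and the holder is \<open>h\<close>. The values \<open>g m m b\<close> are not used.\<close>

definition pair_gain ::
  "(nat \<Rightarrow> 'b \<Rightarrow> real) \<Rightarrow> (nat \<Rightarrow> nat \<Rightarrow> 'b \<Rightarrow> real) \<Rightarrow> nat \<Rightarrow> nat \<Rightarrow> 'b \<Rightarrow> real" where
  "pair_gain w g m h b = (if h = m then w m b else pos_part (w m b - g m h b))"

definition holders :: "nat \<Rightarrow> 'b placement \<Rightarrow> 'b \<Rightarrow> nat set" where
  "holders M T b = {h \<in> {1..M}. b \<in> T h}"

definition F_pair ::
  "nat \<Rightarrow> 'b set \<Rightarrow> (nat \<Rightarrow> 'b \<Rightarrow> real) \<Rightarrow> (nat \<Rightarrow> 'b \<Rightarrow> real) \<Rightarrow> (nat \<Rightarrow> nat \<Rightarrow> 'b \<Rightarrow> real)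
     \<Rightarrow> 'b placement \<Rightarrow> real" where
  "F_pair M V \<Lambda> w g T =
     (\<Sum>b\<in>V. \<Sum>m\<in>{1..M}. \<Lambda> m b *
        (if holders M T b = {} then 0
         else Max ((\<lambda>h. pair_gain w g m h b) ` holders M T b)))"

text \<open>\<open>greedy_run G adm ms T\<close>: processing the workers \<open>ms\<close> from left to right may end in the
  placement \<open>T\<close>. Ties between maximizers are broken arbitrarily, hence a relation.\<close>

inductive greedy_run ::
  "('b placement \<Rightarrow> real) \<Rightarrow> (nat \<Rightarrow> 'b set \<Rightarrow> bool) \<Rightarrow> nat list \<Rightarrow> 'b placement \<Rightarrow> bool"
  for G adm where
  start: "greedy_run G adm [] (\<lambda>_. {})"
| step: "greedy_run G adm ms P \<Longrightarrow>
    is_arg_max (\<lambda>S. G (P(m := S)) - G P) (adm m) S \<Longrightarrow>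
    greedy_run G adm (ms @ [m]) (P(m := S))"

end

theory Submission
  imports Defs
begin

text \<open>Both objectives split over the chunks as a sum of monotone submodular functions of the set of
  holders. When a worker is processed, its block of the optimal placement is one of the candidates,
  so the greedy marginal dominates the increase caused by that block; by diminishing returns it
  also dominates the increase when the block is added to the final greedy placement together with
  the earlier optimal blocks. Summing over the workers, adding the whole optimal placement to the
  greedy one gains at most the value of the greedy one.\<close>

section \<open>Monotone submodular set functions\<close>

text \<open>The case \<open>x \<in> B\<close> is allowed: the left increment is then zero and the
  inequality amounts to monotonicity. Hence a block may contain chunks that its worker already
  holds, without a case split.\<close>

definition monotone_submodular :: "'a set \<Rightarrow> ('a set \<Rightarrow> real) \<Rightarrow> bool" where
  "monotone_submodular E \<phi> \<longleftrightarrow> \<phi> {} = 0 \<and>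
     (\<forall>A B. A \<subseteq> B \<and> B \<subseteq> E \<longrightarrow> \<phi> A \<le> \<phi> B) \<and>
     (\<forall>A B x. A \<subseteq> B \<and> B \<subseteq> E \<and> x \<in> E \<longrightarrow>
        \<phi> (insert x B) - \<phi> B \<le> \<phi> (insert x A) - \<phi> A)"

lemma monotone_submodular_empty:
  "monotone_submodular E \<phi> \<Longrightarrow> \<phi> {} = 0"
  by (simp add: monotone_submodular_def)

lemma monotone_submodular_mono:
  "monotone_submodular E \<phi> \<Longrightarrow> A \<subseteq> B \<Longrightarrow> B \<subseteq> E \<Longrightarrow> \<phi> A \<le> \<phi> B"
  by (simp add: monotone_submodular_def)

lemma monotone_submodular_diminishing:
  "monotone_submodular E \<phi> \<Longrightarrow> A \<subseteq> B \<Longrightarrow> B \<subseteq> E \<Longrightarrow> x \<in> E \<Longrightarrow>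
     \<phi> (insert x B) - \<phi> B \<le> \<phi> (insert x A) - \<phi> A"
  by (simp add: monotone_submodular_def)

lemma monotone_submodular_add:
  assumes "monotone_submodular E \<phi>" and "monotone_submodular E \<psi>"
  shows "monotone_submodular E (\<lambda>A. \<phi> A + \<psi> A)"
proof -
  have "\<phi> (insert x B) + \<psi> (insert x B) - (\<phi> B + \<psi> B)
      \<le> \<phi> (insert x A) + \<psi> (insert x A) - (\<phi> A + \<psi> A)"
    if "A \<subseteq> B" "B \<subseteq> E" "x \<in> E" for A B x
    using monotone_submodular_diminishing[OF assms(1) that]
      monotone_submodular_diminishing[OF assms(2) that] by linarith
  moreover have "\<phi> A + \<psi> A \<le> \<phi> B + \<psi> B" if "A \<subseteq> B" "B \<subseteq> E" for A B
    using assms that by (intro add_mono monotone_submodular_mono)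
  moreover have "\<phi> {} + \<psi> {} = 0"
    using assms[THEN monotone_submodular_empty] by simp
  ultimately show ?thesis
    unfolding monotone_submodular_def by blast
qed

lemma monotone_submodular_weighted_sum:
  assumes "\<And>i. i \<in> I \<Longrightarrow> 0 \<le> c i" and "\<And>i. i \<in> I \<Longrightarrow> monotone_submodular E (\<phi> i)"
  shows "monotone_submodular E (\<lambda>A. \<Sum>i\<in>I. c i * \<phi> i A)"
proof -
  have "(\<Sum>i\<in>I. c i * \<phi> i (insert x B)) - (\<Sum>i\<in>I. c i * \<phi> i B)
      \<le> (\<Sum>i\<in>I. c i * \<phi> i (insert x A)) - (\<Sum>i\<in>I. c i * \<phi> i A)"
    if "A \<subseteq> B" "B \<subseteq> E" "x \<in> E" for A B x
    unfolding sum_subtractf[symmetric] right_diff_distrib[symmetric]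
    using assms that by (intro sum_mono mult_left_mono monotone_submodular_diminishing) auto
  moreover have "(\<Sum>i\<in>I. c i * \<phi> i A) \<le> (\<Sum>i\<in>I. c i * \<phi> i B)" if "A \<subseteq> B" "B \<subseteq> E" for A B
    using assms that by (intro sum_mono mult_left_mono monotone_submodular_mono) auto
  moreover have "(\<Sum>i\<in>I. c i * \<phi> i {}) = 0"
    by (simp add: monotone_submodular_empty[OF assms(2)])
  ultimately show ?thesis
    unfolding monotone_submodular_def by blast
qed

lemma monotone_submodular_sum:
  assumes "finite E" and "\<And>x. x \<in> E \<Longrightarrow> 0 \<le> a x"
  shows "monotone_submodular E (\<lambda>A. sum a A)"
  unfolding monotone_submodular_def
proof (intro conjI allI impI)
  fix A B x
  assume "A \<subseteq> B \<and> B \<subseteq> E"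
  then show "sum a A \<le> sum a B"
    using assms by (intro sum_mono2) (auto intro: finite_subset)
next
  fix A B x
  assume *: "A \<subseteq> B \<and> B \<subseteq> E \<and> x \<in> E"
  then have "finite A" "finite B"
    using assms(1) by (auto intro: finite_subset)
  then show "sum a (insert x B) - sum a B \<le> sum a (insert x A) - sum a A"
    using * assms(2) by (auto simp: sum.insert_if)
qed simp

text \<open>Inserting \<open>x\<close> turns a value \<open>v\<close> into
  \<open>max (q x) v\<close>, an increment that shrinks as \<open>v\<close> grows. Since
  \<open>q\<close> is nonnegative on \<open>E\<close>, the default 0 for the empty set is neutral
  for \<open>max\<close>, so this description also covers the first insertion.\<close>

lemma monotone_submodular_Max:
  assumes "finite E" and "\<And>x. x \<in> E \<Longrightarrow> 0 \<le> q x"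
  shows "monotone_submodular E (\<lambda>A. if A = {} then 0 else Max (q ` A))"
    (is "monotone_submodular E ?\<phi>")
proof -
  have insert: "?\<phi> (insert x A) = max (q x) (?\<phi> A)" if "A \<subseteq> E" "x \<in> E" for A x
    using that assms finite_subset[OF that(1)] by auto
  have mono: "?\<phi> A \<le> ?\<phi> B" if "A \<subseteq> B" "B \<subseteq> E" for A B
  proof (cases "A = {}")
    case True
    have "0 \<le> Max (q ` B)" if "B \<noteq> {}"
    proof -
      from that obtain x where "x \<in> B" by blast
      then show ?thesis
        using assms \<open>B \<subseteq> E\<close> finite_subset[OF \<open>B \<subseteq> E\<close>] by (subst Max_ge_iff) auto
    qed
    with True show ?thesis by simp
  next
    case False
    then show ?thesis
      using that finite_subset[OF that(2) assms(1)] by (auto intro!: Max_mono)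
  qed
  have "?\<phi> (insert x B) - ?\<phi> B \<le> ?\<phi> (insert x A) - ?\<phi> A"
    if "A \<subseteq> B" "B \<subseteq> E" "x \<in> E" for A B x
  proof -
    have "max y v - v \<le> max y u - u" if "u \<le> v" for u v y :: real
      using that by linarith
    with mono[of A B] that show ?thesis
      by (simp only: insert[of B x] insert[of A x] subset_trans[of A B E])
  qed
  with mono show ?thesis
    unfolding monotone_submodular_def by simp
qed

section \<open>Objectives that split over the chunks\<close>

lemma holders_subset: "holders M T b \<subseteq> {1..M}"
  by (auto simp: holders_def)

definition chunkwise :: "nat \<Rightarrow> 'b set \<Rightarrow> ('b \<Rightarrow> nat set \<Rightarrow> real) \<Rightarrow> 'b placement \<Rightarrow> real" where
  "chunkwise M V \<phi> T = (\<Sum>b\<in>V. \<phi> b (holders M T b))"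

lemma chunkwise_mono:
  assumes "\<And>b. b \<in> V \<Longrightarrow> monotone_submodular {1..M} (\<phi> b)"
    and "\<And>m. m \<in> {1..M} \<Longrightarrow> P m \<subseteq> Q m"
  shows "chunkwise M V \<phi> P \<le> chunkwise M V \<phi> Q"
  unfolding chunkwise_def
  using assms by (intro sum_mono monotone_submodular_mono holders_subset) (auto simp: holders_def)

text \<open>For a fixed chunk, giving the block \<open>S\<close> to worker \<open>m\<close> either
  inserts the single element \<open>m\<close> into the set of holders or changes nothing.
  One-element diminishing returns therefore suffice for whole blocks.\<close>

lemma chunkwise_diminishing:
  assumes "\<And>b. b \<in> V \<Longrightarrow> monotone_submodular {1..M} (\<phi> b)"
    and "\<And>h. h \<in> {1..M} \<Longrightarrow> P h \<subseteq> Q h" and "m \<in> {1..M}"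
  shows "chunkwise M V \<phi> (Q(m := Q m \<union> S)) - chunkwise M V \<phi> Q
       \<le> chunkwise M V \<phi> (P(m := P m \<union> S)) - chunkwise M V \<phi> P"
  unfolding chunkwise_def sum_subtractf[symmetric]
proof (rule sum_mono)
  fix b assume "b \<in> V"
  have upd: "holders M (T(m := T m \<union> S)) b =
      (if b \<in> S then insert m (holders M T b) else holders M T b)" for T
    using assms(3) by (auto simp: holders_def)
  have "holders M P b \<subseteq> holders M Q b"
    using assms(2) by (auto simp: holders_def)
  with assms(1)[OF \<open>b \<in> V\<close>] assms(3)
  show "\<phi> b (holders M (Q(m := Q m \<union> S)) b) - \<phi> b (holders M Q b)
      \<le> \<phi> b (holders M (P(m := P m \<union> S)) b) - \<phi> b (holders M P b)"
    unfolding upd using monotone_submodular_diminishing holders_subset by (smt (verit))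
qed

section \<open>Analysis of the greedy run\<close>

text \<open>The second conjunct ensures that the update made when a worker is processed overwrites
  an empty block, so it coincides with adding the new block.\<close>

lemma greedy_run_admissible:
  assumes "greedy_run G adm ms T"
  shows "(\<forall>m\<in>set ms. adm m (T m)) \<and> (\<forall>m. m \<notin> set ms \<longrightarrow> T m = {})"
  using assms by induction (auto simp: is_arg_max_def)

text \<open>The bound is needed only for \<open>Q = T\<close>; it is stated for all larger \<open>Q\<close> so that the
  induction hypothesis, about a partial run, applies to the final placement.\<close>

lemma greedy_run_gain:
  fixes G :: "'b placement \<Rightarrow> real" and T opt :: "'b placement"
  assumes run: "greedy_run G adm ms T"
    and G: "\<And>T. (\<And>m. m \<in> {1..M} \<Longrightarrow> T m \<subseteq> V) \<Longrightarrow> G T = chunkwise M V \<phi> T"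
    and sub: "\<And>b. b \<in> V \<Longrightarrow> monotone_submodular {1..M} (\<phi> b)"
    and adm: "\<And>m S. m \<in> {1..M} \<Longrightarrow> adm m S \<Longrightarrow> S \<subseteq> V"
    and opt: "\<And>m. m \<in> {1..M} \<Longrightarrow> adm m (opt m)"
    and "distinct ms" "set ms \<subseteq> {1..M}"
    and "\<And>m. m \<in> {1..M} \<Longrightarrow> T m \<subseteq> Q m"
  shows "chunkwise M V \<phi> (\<lambda>m. if m \<in> set ms then Q m \<union> opt m else Q m) - chunkwise M V \<phi> Q
       \<le> chunkwise M V \<phi> T"
  using run assms(6-)
proof (induction arbitrary: Q)
  case start
  then show ?case
    by (simp add: chunkwise_def holders_def monotone_submodular_empty[OF sub])
next
  case (step ms P m S)
  let ?c = "chunkwise M V \<phi>"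
  let ?R = "\<lambda>h. if h \<in> set ms then Q h \<union> opt h else Q h"
  have m: "m \<in> {1..M}" "m \<notin> set ms" using step.prems by auto
  have P: "P m = {}" "\<And>h. h \<in> {1..M} \<Longrightarrow> P h \<subseteq> V"
    using greedy_run_admissible[OF step.hyps(1)] adm m by blast+
  \<comment> \<open>The premise on \<open>Q\<close> concerns \<open>P(m := S)\<close>; at
    \<open>m\<close> itself the inclusion comes from \<open>P m = {}\<close>.\<close>
  have PQ: "P h \<subseteq> Q h" if "h \<in> {1..M}" for h
    using step.prems(3)[OF that] P(1) by (cases "h = m") auto
  have S: "adm m S" using step.hyps by (simp add: is_arg_max_def)
  have GP: "G (P(m := X)) = ?c (P(m := X))" if "adm m X" for X
    using that P(2) adm[OF m(1)] by (intro G) auto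
  \<comment> \<open>\<open>?R\<close> is \<open>Q\<close> enlarged by the optimal blocks of the
    earlier workers, so it contains \<open>P\<close> and gains no more from \<open>opt m\<close>
    than \<open>P\<close> does.\<close>
  have "?c (?R(m := ?R m \<union> opt m)) - ?c ?R \<le> ?c (P(m := P m \<union> opt m)) - ?c P"
    using sub PQ m(1) by (intro chunkwise_diminishing) auto
  \<comment> \<open>\<open>opt m\<close> competes with \<open>S\<close> in the greedy choice, and
    \<open>P m \<union> opt m\<close> is just \<open>opt m\<close>. The baseline \<open>G P\<close>
    is common to both marginals and cancels.\<close>
  also have "\<dots> \<le> ?c (P(m := S)) - ?c P"
    using step.hyps(2) opt[OF m(1)] P(1) GP[OF S] GP[OF opt[OF m(1)]]
    by (auto simp: is_arg_max_def not_less)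
  finally have "?c (?R(m := ?R m \<union> opt m)) - ?c ?R \<le> ?c (P(m := S)) - ?c P" .
  \<comment> \<open>The induction hypothesis is used with the same \<open>Q\<close>; added to the
    previous bound, the terms \<open>?c ?R\<close> and \<open>?c P\<close> telescope.\<close>
  moreover have "?c ?R - ?c Q \<le> ?c P"
    using step.prems PQ by (intro step.IH) auto
  moreover have upd: "?R(m := ?R m \<union> opt m) =
      (\<lambda>h. if h \<in> set (ms @ [m]) then Q h \<union> opt h else Q h)"
    using m by (simp add: fun_eq_iff)
  ultimately show ?case unfolding upd by linarith
qed

text \<open>With \<open>Q = T\<close> in \<open>greedy_run_gain\<close>, the union of the greedy and
  the optimal placement is worth at most twice the greedy one; by monotonicity it is worth at least
  the optimal one.\<close>

lemma greedy_run_half: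
  fixes G :: "'b placement \<Rightarrow> real" and T opt :: "'b placement"
  assumes run: "greedy_run G adm ms T"
    and G: "\<And>T. (\<And>m. m \<in> {1..M} \<Longrightarrow> T m \<subseteq> V) \<Longrightarrow> G T = chunkwise M V \<phi> T"
    and sub: "\<And>b. b \<in> V \<Longrightarrow> monotone_submodular {1..M} (\<phi> b)"
    and adm: "\<And>m S. m \<in> {1..M} \<Longrightarrow> adm m S \<Longrightarrow> S \<subseteq> V"
    and opt: "\<And>m. m \<in> {1..M} \<Longrightarrow> adm m (opt m)"
    and ms: "distinct ms" "set ms = {1..M}"
  shows "1 / 2 * G opt \<le> G T"
proof -
  have "chunkwise M V \<phi> (\<lambda>m. if m \<in> set ms then T m \<union> opt m else T m)
      - chunkwise M V \<phi> T \<le> chunkwise M V \<phi> T"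
    using ms by (intro greedy_run_gain[OF run G sub adm opt]) auto
  moreover have "chunkwise M V \<phi> opt
      \<le> chunkwise M V \<phi> (\<lambda>m. if m \<in> set ms then T m \<union> opt m else T m)"
    using sub ms by (intro chunkwise_mono) auto
  moreover have "G opt = chunkwise M V \<phi> opt"
    using adm opt by (intro G) auto
  moreover have "G T = chunkwise M V \<phi> T"
    using adm greedy_run_admissible[OF run] ms by (intro G) auto
  ultimately show ?thesis by simp
qed

section \<open>The two objectives in chunkwise form\<close>

text \<open>Exchanging the sums groups the local gains by chunk, and the union consists of the
  chunks with at least one holder. The shared gain is written as the maximum of a constant so that
  \<open>monotone_submodular_Max\<close> covers this coverage term.\<close>

lemma F_eq_chunkwise:
  assumes "finite V" and "\<And>m. m \<in> {1..M} \<Longrightarrow> T m \<subseteq> V"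
  shows "F M \<Lambda> w f T = chunkwise M V (\<lambda>b H. (\<Sum>m\<in>H. local_gain \<Lambda> w f m b)
    + (if H = {} then 0 else Max ((\<lambda>_. shared_gain M \<Lambda> w f b) ` H))) T"
proof -
  have "(\<Sum>m\<in>{1..M}. \<Sum>b\<in>T m. local_gain \<Lambda> w f m b)
      = (\<Sum>m\<in>{1..M}. \<Sum>b\<in>V. if b \<in> T m then local_gain \<Lambda> w f m b else 0)"
  proof (rule sum.cong[OF refl])
    fix m assume "m \<in> {1..M}"
    then have "T m = {b \<in> V. b \<in> T m}" using assms(2) by blast
    then show "(\<Sum>b\<in>T m. local_gain \<Lambda> w f m b)
        = (\<Sum>b\<in>V. if b \<in> T m then local_gain \<Lambda> w f m b else 0)"
      using sum.inter_filter[OF assms(1), of "\<lambda>b. local_gain \<Lambda> w f m b" "\<lambda>b. b \<in> T m"] by simp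
  qed
  also have "\<dots> = (\<Sum>b\<in>V. \<Sum>m\<in>{1..M}. if b \<in> T m then local_gain \<Lambda> w f m b else 0)"
    by (rule sum.swap)
  also have "\<dots> = (\<Sum>b\<in>V. \<Sum>m\<in>holders M T b. local_gain \<Lambda> w f m b)"
    unfolding holders_def by (simp only: sum.inter_filter finite_atLeastAtMost)
  finally have "(\<Sum>m\<in>{1..M}. \<Sum>b\<in>T m. local_gain \<Lambda> w f m b)
      = (\<Sum>b\<in>V. \<Sum>m\<in>holders M T b. local_gain \<Lambda> w f m b)" .
  moreover have "(\<Union>m\<in>{1..M}. T m) = {b \<in> V. holders M T b \<noteq> {}}"
    using assms(2) unfolding holders_def by blast
  then have "(\<Sum>b\<in>(\<Union>m\<in>{1..M}. T m). shared_gain M \<Lambda> w f b)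
      = (\<Sum>b\<in>V. if holders M T b \<noteq> {} then shared_gain M \<Lambda> w f b else 0)"
    by (simp only: sum.inter_filter[OF assms(1)])
  moreover have "(if H \<noteq> {} then c else 0) = (if H = {} then 0 else Max ((\<lambda>_. c) ` H))"
    for H :: "nat set" and c :: real
    by (simp add: image_constant_conv)
  ultimately show ?thesis
    unfolding F_def chunkwise_def by (simp only: sum.distrib)
qed

theorem theorem3:
  fixes N V :: "'b set" and r :: 'b and par :: "'b \<Rightarrow> 'b"
    and M :: nat and k :: "nat \<Rightarrow> nat" and order :: "nat list"
    and \<Lambda> w f :: "nat \<Rightarrow> 'b \<Rightarrow> real" and g :: "nat \<Rightarrow> nat \<Rightarrow> 'b \<Rightarrow> real"
    and G :: "'b placement \<Rightarrow> real" and T_greedy T_opt :: "'b placement"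
  assumes "cache_tree N r par V"
    and "\<And>m b. m \<in> {1..M} \<Longrightarrow> b \<in> V \<Longrightarrow> \<Lambda> m b \<ge> 0"
    and "\<And>m b. m \<in> {1..M} \<Longrightarrow> b \<in> V \<Longrightarrow> w m b \<ge> 0"
    and "((\<forall>m\<in>{1..M}. \<forall>b\<in>V. f m b \<ge> 0) \<and> G = F M \<Lambda> w f) \<or> G = F_pair M V \<Lambda> w g"
    and "distinct order" and "set order = {1..M}"
    and "greedy_run G (\<lambda>m. admissible N r par V (k m)) order T_greedy"
    and "is_arg_max G (feasible N r par V M k) T_opt"
  shows "feasible N r par V M k T_greedy \<and> G T_greedy \<ge> 1 / 2 * G T_opt"
proof -
  let ?adm = "\<lambda>m. admissible N r par V (k m)"
  have fin: "finite V" using assms(1) by (simp add: cache_tree_def)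
  have adm: "S \<subseteq> V" if "m \<in> {1..M}" "?adm m S" for m S
    using that(2) by (simp add: admissible_def)
  have opt: "?adm m (T_opt m)" if "m \<in> {1..M}" for m
    using assms(8) that by (auto simp: is_arg_max_def feasible_def)
  obtain \<phi> where G: "\<And>T. (\<And>m. m \<in> {1..M} \<Longrightarrow> T m \<subseteq> V) \<Longrightarrow> G T = chunkwise M V \<phi> T"
    and sub: "\<And>b. b \<in> V \<Longrightarrow> monotone_submodular {1..M} (\<phi> b)"
    using assms(4)
  proof (elim disjE conjE)
    assume f: "\<forall>m\<in>{1..M}. \<forall>b\<in>V. f m b \<ge> 0" and G: "G = F M \<Lambda> w f"
    show thesis
    proof (rule that)
      show "G T = chunkwise M V (\<lambda>b H. (\<Sum>m\<in>H. local_gain \<Lambda> w f m b)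
          + (if H = {} then 0 else Max ((\<lambda>_. shared_gain M \<Lambda> w f b) ` H))) T"
        if "\<And>m. m \<in> {1..M} \<Longrightarrow> T m \<subseteq> V" for T
        unfolding G by (rule F_eq_chunkwise[OF fin that])
      show "monotone_submodular {1..M} (\<lambda>H. (\<Sum>m\<in>H. local_gain \<Lambda> w f m b)
          + (if H = {} then 0 else Max ((\<lambda>_. shared_gain M \<Lambda> w f b) ` H)))" if "b \<in> V" for b
        \<comment> \<open>Nonnegativity of \<open>f\<close> enters through the minimum in
          \<open>local_gain\<close>.\<close>
        using that f assms(2,3)
        by (intro monotone_submodular_add monotone_submodular_sum monotone_submodular_Max)
          (auto simp: local_gain_def shared_gain_def pos_part_def intro!: sum_nonneg)
    qed
  next
    assume G: "G = F_pair M V \<Lambda> w g"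
    show thesis
    proof (rule that)
      show "G T = chunkwise M V (\<lambda>b H. \<Sum>m\<in>{1..M}. \<Lambda> m b *
          (if H = {} then 0 else Max ((\<lambda>h. pair_gain w g m h b) ` H))) T" for T
        by (simp add: G F_pair_def chunkwise_def)
      show "monotone_submodular {1..M} (\<lambda>H. \<Sum>m\<in>{1..M}. \<Lambda> m b *
          (if H = {} then 0 else Max ((\<lambda>h. pair_gain w g m h b) ` H)))" if "b \<in> V" for b
        \<comment> \<open>\<open>pos_part\<close> keeps the gain from a remote holder nonnegative
          for fetch costs \<open>g\<close> of either sign; for \<open>h = m\<close> the gain is
          \<open>w m b\<close>, nonnegative by assumption.\<close>
        using that assms(2,3)
        by (intro monotone_submodular_weighted_sum monotone_submodular_Max)
          (auto simp: pair_gain_def pos_part_def)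
    qed
  qed
  have "feasible N r par V M k T_greedy"
    using greedy_run_admissible[OF assms(7)] assms(6) by (simp add: feasible_def)
  moreover have "1 / 2 * G T_opt \<le> G T_greedy"
    by (intro greedy_run_half[OF assms(7) G sub adm opt assms(5,6)]) auto
  ultimately show ?thesis by blast
qed

end
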